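(* Let $N\ge1$ and $n\in\mathbb Z$. In the $A_{N-1}$ double affine Hecke algebra, the elements $$Y_{i,n}=(X_1X_2\cdots X_{i-1})^{-n}\,Y_i\,(X_1X_2\cdots X_i)^n,\qquad i=1,\dots,N,$$ commute among themselves: $Y_{i,n}Y_{j,n}=Y_{j,n}Y_{i,n}$ for all $i,j\in[1,N]$.
   Context: Let $q,\theta$ be indeterminates ($t=\theta^2$). The $A_{N-1}$ double affine Hecke algebra is the algebra over $\mathbb C(q,\theta)$ generated by invertible elements $X_i,Y_i$ ($1\le i\le N$) and $T_j$ ($1\le j\le N-1$) subject to the relations: - $T_iT_{i+1}T_i=T_{i+1}T_iT_{i+1}$; $T_iT_j=T_jT_i$ for $|i-j|\ge2$; $(T_i-\theta)(T_i+\theta^{-1})=0$; - $T_iX_iT_i=X_{i+1}$, $T_i^{-1}Y_iT_i^{-1}=Y_{i+1}$ for $1\le i\le N-1$; - $T_iX_j=X_jT_i$, $T_iY_j=Y_jT_i$ for $j\ne i,i+1$; - $X_1Y_2=Y_2T_1^2X_1$; - $X_iX_j=X_jX_i$, $Y_iY_j=Y_jY_i$; - $(Y_1\cdots Y_N)X_j=q\,X_j(Y_1\cdots Y_N)$, $(X_1\cdots X_N)Y_j=q^{-1}Y_j(X_1\cdots X_N)$. *)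

theory Defs
  imports
    "HOL-Library.Poly_Mapping"
    "HOL-Computational_Algebra.Polynomial"
    "HOL-Computational_Algebra.Fraction_Field"
    "HOL-Algebra.QuotRing"
begin

text \<open>
  The field \<open>\<complex>(q, \<theta>)\<close> as the fraction field of \<open>\<complex>[q][\<theta>]\<close>: the inner polynomial
  variable is \<open>q\<close>, the outer one is
  \<open>\<theta>\<close>.
\<close>

type_synonym scalar = "complex poly poly fract"

definition daha_q :: scalar where
  "daha_q = Fract [:[:0, 1:]:] 1"

definition daha_\<theta> :: scalar where
  "daha_\<theta> = Fract [:0, 1:] 1"

text \<open>
  The free monoid, written additively so that the convolution product of \<open>Poly_Mapping\<close> makes
  \<open>'g free_word \<Rightarrow>\<^sub>0 'k\<close> the free (noncommutative) unital \<open>'k\<close>-algebra on \<open>'g\<close>.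
\<close>

datatype 'g free_word = Free_Word (letters: "'g list")

instantiation free_word :: (type) monoid_add
begin

definition zero_free_word :: "'a free_word" where
  "0 = Free_Word []"

definition plus_free_word :: "'a free_word \<Rightarrow> 'a free_word \<Rightarrow> 'a free_word" where
  "v + w = Free_Word (letters v @ letters w)"

instance
  by standard (simp_all add: zero_free_word_def plus_free_word_def)

end

definition free_gen :: "'g \<Rightarrow> ('g free_word \<Rightarrow>\<^sub>0 'k::ring_1)" where
  "free_gen g = Poly_Mapping.single (Free_Word [g]) 1"

definition free_const :: "'k \<Rightarrow> ('g free_word \<Rightarrow>\<^sub>0 'k::ring_1)" where
  "free_const c = Poly_Mapping.single 0 c"

definition free_algebra :: "'g set \<Rightarrow> ('g free_word \<Rightarrow>\<^sub>0 'k::ring_1) ring" where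
  "free_algebra G =
    \<lparr>carrier = {f. \<forall>w \<in> Poly_Mapping.keys f. set (letters w) \<subseteq> G},
     mult = (*), one = 1, zero = 0, add = (+)\<rparr>"

lemma free_algebra_simps [simp]:
  "mult (free_algebra G) = (*)" "one (free_algebra G) = 1"
  "zero (free_algebra G) = 0" "add (free_algebra G) = (+)"
  by (simp_all add: free_algebra_def)

lemma in_free_algebra_iff:
  "f \<in> carrier (free_algebra G) \<longleftrightarrow> (\<forall>w \<in> Poly_Mapping.keys f. set (letters w) \<subseteq> G)"
  by (simp add: free_algebra_def)

lemma free_algebra_carrier_simps:
  "0 \<in> carrier (free_algebra G)"
  "1 \<in> carrier (free_algebra G)"
  "g \<in> G \<Longrightarrow> free_gen g \<in> carrier (free_algebra G)"
  "free_const c \<in> carrier (free_algebra G)"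
  by (auto simp: in_free_algebra_iff free_gen_def free_const_def zero_free_word_def
      split: if_splits)

lemma free_algebra_carrier_closed:
  assumes "a \<in> carrier (free_algebra G)" "b \<in> carrier (free_algebra G)"
  shows "a + b \<in> carrier (free_algebra G)" "a * b \<in> carrier (free_algebra G)"
    "a - b \<in> carrier (free_algebra G)"
proof -
  show "a + b \<in> carrier (free_algebra G)"
    using assms keys_add[of a b] unfolding in_free_algebra_iff by blast
  show "a - b \<in> carrier (free_algebra G)"
    using assms keys_diff[of a b] unfolding in_free_algebra_iff by blast
  show "a * b \<in> carrier (free_algebra G)"
    unfolding in_free_algebra_iff
  proof
    fix w assume "w \<in> Poly_Mapping.keys (a * b)"
    then obtain u v where "w = u + v" "u \<in> Poly_Mapping.keys a" "v \<in> Poly_Mapping.keys b"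
      using keys_mult[of a b] by blast
    with assms show "set (letters w) \<subseteq> G"
      by (simp add: in_free_algebra_iff plus_free_word_def)
  qed
qed

lemma free_algebra_ring: "ring (free_algebra G :: ('g free_word \<Rightarrow>\<^sub>0 'k::ring_1) ring)"
proof (rule ringI)
  let ?F = "free_algebra G :: ('g free_word \<Rightarrow>\<^sub>0 'k) ring"
  show "abelian_group ?F"
  proof (rule abelian_groupI)
    fix f assume "f \<in> carrier ?F"
    then have "- f \<in> carrier ?F" by (simp add: in_free_algebra_iff)
    then show "\<exists>g \<in> carrier ?F. g \<oplus>\<^bsub>?F\<^esub> f = \<zero>\<^bsub>?F\<^esub>"
      by (rule bexI[rotated]) simp
  qed (simp_all add: free_algebra_carrier_simps free_algebra_carrier_closed add_ac)
  show "monoid ?F"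
    by (rule monoidI)
      (simp_all add: free_algebra_carrier_simps free_algebra_carrier_closed mult.assoc)
qed (simp_all add: distrib_left distrib_right)

datatype daha_gen = GX nat | GXinv nat | GY nat | GYinv nat | GT nat | GTinv nat

definition daha_gens :: "nat \<Rightarrow> daha_gen set" where
  "daha_gens N =
    GX ` {1..N} \<union> GXinv ` {1..N} \<union> GY ` {1..N} \<union> GYinv ` {1..N} \<union>
    GT ` {1..<N} \<union> GTinv ` {1..<N}"

type_synonym daha_free = "daha_gen free_word \<Rightarrow>\<^sub>0 scalar"

abbreviation fX :: "nat \<Rightarrow> daha_free" where "fX i \<equiv> free_gen (GX i)"
abbreviation fXinv :: "nat \<Rightarrow> daha_free" where "fXinv i \<equiv> free_gen (GXinv i)"
abbreviation fY :: "nat \<Rightarrow> daha_free" where "fY i \<equiv> free_gen (GY i)"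
abbreviation fYinv :: "nat \<Rightarrow> daha_free" where "fYinv i \<equiv> free_gen (GYinv i)"
abbreviation fT :: "nat \<Rightarrow> daha_free" where "fT i \<equiv> free_gen (GT i)"
abbreviation fTinv :: "nat \<Rightarrow> daha_free" where "fTinv i \<equiv> free_gen (GTinv i)"
abbreviation fC :: "scalar \<Rightarrow> daha_free" where "fC c \<equiv> free_const c"

inductive daha_rel :: "nat \<Rightarrow> daha_free \<Rightarrow> daha_free \<Rightarrow> bool" for N :: nat where
  X_Xinv: "i \<in> {1..N} \<Longrightarrow> daha_rel N (fX i * fXinv i) 1"
| Xinv_X: "i \<in> {1..N} \<Longrightarrow> daha_rel N (fXinv i * fX i) 1"
| Y_Yinv: "i \<in> {1..N} \<Longrightarrow> daha_rel N (fY i * fYinv i) 1"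
| Yinv_Y: "i \<in> {1..N} \<Longrightarrow> daha_rel N (fYinv i * fY i) 1"
| T_Tinv: "i \<in> {1..<N} \<Longrightarrow> daha_rel N (fT i * fTinv i) 1"
| Tinv_T: "i \<in> {1..<N} \<Longrightarrow> daha_rel N (fTinv i * fT i) 1"
| braid: "\<lbrakk>i \<in> {1..<N}; i + 1 \<in> {1..<N}\<rbrakk> \<Longrightarrow>
    daha_rel N (fT i * fT (i + 1) * fT i) (fT (i + 1) * fT i * fT (i + 1))"
| T_T: "\<lbrakk>i \<in> {1..<N}; j \<in> {1..<N}; \<bar>int i - int j\<bar> \<ge> 2\<rbrakk> \<Longrightarrow>
    daha_rel N (fT i * fT j) (fT j * fT i)"
| hecke: "i \<in> {1..<N} \<Longrightarrow>
    daha_rel N ((fT i - fC daha_\<theta>) * (fT i + fC (inverse daha_\<theta>))) 0"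
| TXT: "i \<in> {1..<N} \<Longrightarrow> daha_rel N (fT i * fX i * fT i) (fX (i + 1))"
| TYT: "i \<in> {1..<N} \<Longrightarrow> daha_rel N (fTinv i * fY i * fTinv i) (fY (i + 1))"
| T_X: "\<lbrakk>i \<in> {1..<N}; j \<in> {1..N}; j \<noteq> i; j \<noteq> i + 1\<rbrakk> \<Longrightarrow>
    daha_rel N (fT i * fX j) (fX j * fT i)"
| T_Y: "\<lbrakk>i \<in> {1..<N}; j \<in> {1..N}; j \<noteq> i; j \<noteq> i + 1\<rbrakk> \<Longrightarrow>
    daha_rel N (fT i * fY j) (fY j * fT i)"
| X1_Y2: "2 \<le> N \<Longrightarrow> daha_rel N (fX 1 * fY 2) (fY 2 * fT 1 ^ 2 * fX 1)"
| X_X: "\<lbrakk>i \<in> {1..N}; j \<in> {1..N}\<rbrakk> \<Longrightarrow> daha_rel N (fX i * fX j) (fX j * fX i)"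
| Y_Y: "\<lbrakk>i \<in> {1..N}; j \<in> {1..N}\<rbrakk> \<Longrightarrow> daha_rel N (fY i * fY j) (fY j * fY i)"
| prod_Y_X: "j \<in> {1..N} \<Longrightarrow>
    daha_rel N (prod_list (map fY [1..<N+1]) * fX j)
      (fC daha_q * fX j * prod_list (map fY [1..<N+1]))"
| prod_X_Y: "j \<in> {1..N} \<Longrightarrow>
    daha_rel N (prod_list (map fX [1..<N+1]) * fY j)
      (fC (inverse daha_q) * fY j * prod_list (map fX [1..<N+1]))"

text \<open>
  Scalars lie in the free algebra as constants, so a two-sided ideal is automatically a
  \<open>\<complex>(q, \<theta>)\<close>-subspace and the quotient ring is the quotient algebra.
\<close>

definition daha_ideal :: "nat \<Rightarrow> daha_free set" where
  "daha_ideal N = Idl\<^bsub>free_algebra (daha_gens N)\<^esub> {l - r | l r. daha_rel N l r}"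

definition daha :: "nat \<Rightarrow> daha_free set ring" where
  "daha N = free_algebra (daha_gens N) Quot daha_ideal N"

definition daha_X :: "nat \<Rightarrow> nat \<Rightarrow> daha_free set" where
  "daha_X N i = daha_ideal N +>\<^bsub>free_algebra (daha_gens N)\<^esub> fX i"

definition daha_Y :: "nat \<Rightarrow> nat \<Rightarrow> daha_free set" where
  "daha_Y N i = daha_ideal N +>\<^bsub>free_algebra (daha_gens N)\<^esub> fY i"

fun daha_X_prod :: "nat \<Rightarrow> nat \<Rightarrow> daha_free set" where
  "daha_X_prod N 0 = \<one>\<^bsub>daha N\<^esub>"
| "daha_X_prod N (Suc k) = daha_X_prod N k \<otimes>\<^bsub>daha N\<^esub> daha_X N (Suc k)"

definition daha_Y_twist :: "nat \<Rightarrow> nat \<Rightarrow> int \<Rightarrow> daha_free set" where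
  "daha_Y_twist N i n =
    daha_X_prod N (i - 1) [^]\<^bsub>daha N\<^esub> (- n) \<otimes>\<^bsub>daha N\<^esub> daha_Y N i
      \<otimes>\<^bsub>daha N\<^esub> daha_X_prod N i [^]\<^bsub>daha N\<^esub> n"

lemma free_algebra_prod_list_closed:
  "set xs \<subseteq> carrier (free_algebra G) \<Longrightarrow> prod_list xs \<in> carrier (free_algebra G)"
  by (induction xs) (auto intro: free_algebra_carrier_simps free_algebra_carrier_closed)

lemma daha_rel_carrier:
  assumes "daha_rel N l r"
  shows "l \<in> carrier (free_algebra (daha_gens N))" "r \<in> carrier (free_algebra (daha_gens N))"
  using assms
  by (induction rule: daha_rel.induct)
    (auto intro!: free_algebra_carrier_simps free_algebra_carrier_closed
      free_algebra_prod_list_closed simp: daha_gens_def power2_eq_square)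

lemma daha_ideal_ideal: "ideal (daha_ideal N) (free_algebra (daha_gens N))"
  unfolding daha_ideal_def
  by (rule ring.genideal_ideal[OF free_algebra_ring])
    (auto intro: free_algebra_carrier_closed daha_rel_carrier)

lemma daha_ring: "ring (daha N)"
  unfolding daha_def by (rule ideal.quotient_is_ring[OF daha_ideal_ideal])

lemma daha_rel_imp_coset_eq:
  assumes "daha_rel N l r"
  shows "daha_ideal N +>\<^bsub>free_algebra (daha_gens N)\<^esub> l =
    daha_ideal N +>\<^bsub>free_algebra (daha_gens N)\<^esub> r"
proof -
  let ?F = "free_algebra (daha_gens N) :: daha_free ring"
  interpret ideal "daha_ideal N" ?F by (rule daha_ideal_ideal)
  have lr: "l \<in> carrier ?F" "r \<in> carrier ?F"
    using daha_rel_carrier[OF assms] by simp_all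
  have "{l - r | l r. daha_rel N l r} \<subseteq> daha_ideal N"
    unfolding daha_ideal_def
    by (rule genideal_self) (auto intro: free_algebra_carrier_closed daha_rel_carrier)
  then have mem: "l - r \<in> daha_ideal N" using assms by blast
  have "l = (l - r) \<oplus>\<^bsub>?F\<^esub> r" by simp
  then have "l \<in> daha_ideal N +>\<^bsub>?F\<^esub> r"
    unfolding a_r_coset_def' using mem by blast
  then show ?thesis using a_repr_independence'[OF _ lr(2)] by simp
qed

lemma daha_X_Units:
  assumes i: "i \<in> {1..N}"
  shows "daha_X N i \<in> Units (daha N)"
proof -
  let ?F = "free_algebra (daha_gens N) :: daha_free ring"
  let ?c = "\<lambda>a. daha_ideal N +>\<^bsub>?F\<^esub> a"
  interpret ideal "daha_ideal N" ?F by (rule daha_ideal_ideal)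
  have gens: "fX i \<in> carrier ?F" "fXinv i \<in> carrier ?F"
    using i by (auto intro!: free_algebra_carrier_simps simp: daha_gens_def)
  have "?c (fX i) \<in> carrier (daha N)" "?c (fXinv i) \<in> carrier (daha N)"
    using gens by (auto simp: daha_def FactRing_def A_RCOSETS_def')
  moreover have "?c (fX i) \<otimes>\<^bsub>daha N\<^esub> ?c (fXinv i) = \<one>\<^bsub>daha N\<^esub>"
    using rcoset_mult_add[OF gens] daha_rel_imp_coset_eq[OF daha_rel.X_Xinv[OF i]]
    by (simp add: daha_def FactRing_def)
  moreover have "?c (fXinv i) \<otimes>\<^bsub>daha N\<^esub> ?c (fX i) = \<one>\<^bsub>daha N\<^esub>"
    using rcoset_mult_add[OF gens(2) gens(1)] daha_rel_imp_coset_eq[OF daha_rel.Xinv_X[OF i]]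
    by (simp add: daha_def FactRing_def)
  ultimately show ?thesis
    unfolding Units_def daha_X_def by blast
qed

end

theory Submission
  imports Defs
begin

text \<open>
  From \<open>X\<^sub>1 Y\<^sub>2 = Y\<^sub>2 T\<^sub>1\<^sup>2 X\<^sub>1\<close> and the braid relations, \<open>X\<^sub>i Y\<^bsub>i+1\<^esub> = Y\<^bsub>i+1\<^esub> T\<^sub>i\<^sup>2 X\<^sub>i\<close> for all \<open>i\<close>; since
  \<open>T\<^sub>i X\<^sub>i T\<^sub>i = X\<^bsub>i+1\<^esub>\<close>, this says that \<open>Y\<^bsub>i+1\<^esub> T\<^sub>i\<close> intertwines \<open>X\<^sub>i\<close> and \<open>X\<^bsub>i+1\<^esub>\<close>, hence also their
  \<open>n\<close>-th powers. It follows that the twisted elements satisfy the relations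
  \<open>T\<^sub>i\<^sup>-\<^sup>1 Y\<^bsub>i,n\<^esub> T\<^sub>i\<^sup>-\<^sup>1 = Y\<^bsub>i+1,n\<^esub>\<close> and \<open>T\<^sub>j Y\<^bsub>i,n\<^esub> = Y\<^bsub>i,n\<^esub> T\<^sub>j\<close> for \<open>j \<noteq> i - 1, i\<close> of the \<open>Y\<^sub>i\<close>, which reduce the
  claim to \<open>Y\<^bsub>1,n\<^esub> Y\<^bsub>2,n\<^esub> = Y\<^bsub>2,n\<^esub> Y\<^bsub>1,n\<^esub>\<close>; both sides equal \<open>Y\<^sub>1 Y\<^sub>2 (X\<^sub>1 X\<^sub>2)\<^sup>n\<close>. Only relations between
  invertible elements occur, so the argument takes place in the group of units.
\<close>

section \<open>Powers and commutation in an arbitrary group\<close>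

context group
begin

text \<open>Conjugation by \<open>y\<close> carries \<open>z\<close> to \<open>x\<close>, hence
  powers to powers. The case \<open>x = z\<close> passes commutation on to powers.\<close>

lemma int_pow_intertwine:
  assumes "x \<otimes> y = y \<otimes> z" "x \<in> carrier G" "y \<in> carrier G" "z \<in> carrier G"
  shows "x [^] (k::int) \<otimes> y = y \<otimes> z [^] k"
proof -
  have nat: "x [^] m \<otimes> y = y \<otimes> z [^] m" for m :: nat
  proof (induction m)
    case (Suc m)
    have "x [^] Suc m \<otimes> y = x [^] m \<otimes> (x \<otimes> y)"
      using assms(2-) by (simp add: m_assoc)
    also have "\<dots> = x [^] m \<otimes> y \<otimes> z"
      unfolding assms(1) using assms(2-) by (simp add: m_assoc)
    also have "\<dots> = y \<otimes> z [^] Suc m"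
      unfolding Suc using assms(2-) by (simp add: m_assoc)
    finally show ?case .
  qed (use assms in simp)
  have neg: "inv (x [^] m) \<otimes> y = y \<otimes> inv (z [^] m)" for m :: nat
  proof -
    have "inv (x [^] m) \<otimes> y = inv (x [^] m) \<otimes> (y \<otimes> z [^] m) \<otimes> inv (z [^] m)"
      using assms(2-) by (simp add: m_assoc)
    also have "\<dots> = y \<otimes> inv (z [^] m)"
      unfolding nat[symmetric] using assms(2-) by (simp flip: m_assoc)
    finally show ?thesis .
  qed
  show ?thesis
    by (cases "k < 0") (simp_all only: int_pow_def2 if_True if_False nat neg)
qed

lemma int_pow_cancel:
  assumes "x \<in> carrier G" "z \<in> carrier G"
  shows "x [^] (- n :: int) \<otimes> (x [^] n \<otimes> z) = z" "x [^] n \<otimes> (x [^] (- n :: int) \<otimes> z) = z"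
  using assms by (simp_all add: int_pow_neg flip: m_assoc)

text \<open>Makes a relation between two-letter words applicable at the head of a longer word that
  \<open>m_assoc\<close> has bracketed to the right.\<close>

lemma mult_assoc_cong:
  assumes "a \<otimes> b = c \<otimes> d"
    and "a \<in> carrier G" "b \<in> carrier G" "c \<in> carrier G" "d \<in> carrier G" "z \<in> carrier G"
  shows "a \<otimes> (b \<otimes> z) = c \<otimes> (d \<otimes> z)"
  unfolding m_assoc[OF assms(2,3,6), symmetric] assms(1) using assms(4-) by (rule m_assoc)

text \<open>\<open>z'\<close> is \<open>z\<close> with the inverse of \<open>t\<close> on both
  sides, and \<open>w\<close> commutes with \<open>t\<close> and \<open>z\<close>. This carries
  commutation from one index to the next.\<close>

lemma commute_sandwich:
  assumes "t \<otimes> z' \<otimes> t = z" "t \<otimes> w = w \<otimes> t" "z \<otimes> w = w \<otimes> z"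
    and "t \<in> carrier G" "z' \<in> carrier G" "w \<in> carrier G"
  shows "z' \<otimes> w = w \<otimes> z'"
proof -
  have "t \<otimes> (z' \<otimes> w) \<otimes> t = t \<otimes> z' \<otimes> (w \<otimes> t)"
    using assms(4-) by (simp add: m_assoc)
  also have "\<dots> = z \<otimes> w"
    unfolding assms(1,2)[symmetric] using assms(4-) by (simp add: m_assoc)
  also have "\<dots> = w \<otimes> t \<otimes> (z' \<otimes> t)"
    unfolding assms(3) unfolding assms(1)[symmetric] using assms(4-) by (simp add: m_assoc)
  also have "\<dots> = t \<otimes> (w \<otimes> z') \<otimes> t"
    unfolding assms(2)[symmetric] using assms(4-) by (simp add: m_assoc)
  finally show ?thesis
    using assms by simp
qed

end

text \<open>Purely multiplicative relations, so a group suffices. \<open>TYT\<close> is solved for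
  \<open>Y i\<close> to avoid inverses. The product \<open>P k\<close> of the first \<open>k\<close>
  of the \<open>X i\<close> is a parameter, so that \<open>daha_X_prod\<close> can be put in its
  place.\<close>

locale double_affine_braid = group G for G (structure) +
  fixes N :: nat and X Y T P :: "nat \<Rightarrow> 'a"
  assumes X_closed [simp]: "\<lbrakk>1 \<le> i; i \<le> N\<rbrakk> \<Longrightarrow> X i \<in> carrier G"
    and Y_closed [simp]: "\<lbrakk>1 \<le> i; i \<le> N\<rbrakk> \<Longrightarrow> Y i \<in> carrier G"
    and T_closed [simp]: "\<lbrakk>1 \<le> i; i < N\<rbrakk> \<Longrightarrow> T i \<in> carrier G"
    and P_0: "P 0 = \<one>"
    and P_Suc: "P (Suc k) = P k \<otimes> X (Suc k)"
    and braid: "\<lbrakk>1 \<le> i; Suc i < N\<rbrakk> \<Longrightarrow>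
      T i \<otimes> T (Suc i) \<otimes> T i = T (Suc i) \<otimes> T i \<otimes> T (Suc i)"
    and TXT: "\<lbrakk>1 \<le> i; i < N\<rbrakk> \<Longrightarrow> T i \<otimes> X i \<otimes> T i = X (Suc i)"
    and TYT: "\<lbrakk>1 \<le> i; i < N\<rbrakk> \<Longrightarrow> T i \<otimes> Y (Suc i) \<otimes> T i = Y i"
    and T_X: "\<lbrakk>1 \<le> i; i < N; 1 \<le> j; j \<le> N; j \<noteq> i; j \<noteq> Suc i\<rbrakk> \<Longrightarrow> T i \<otimes> X j = X j \<otimes> T i"
    and T_Y: "\<lbrakk>1 \<le> i; i < N; 1 \<le> j; j \<le> N; j \<noteq> i; j \<noteq> Suc i\<rbrakk> \<Longrightarrow> T i \<otimes> Y j = Y j \<otimes> T i"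
    and X1_Y2: "2 \<le> N \<Longrightarrow> X 1 \<otimes> Y 2 = Y 2 \<otimes> T 1 \<otimes> T 1 \<otimes> X 1"
    and X_X: "\<lbrakk>1 \<le> i; i \<le> N; 1 \<le> j; j \<le> N\<rbrakk> \<Longrightarrow> X i \<otimes> X j = X j \<otimes> X i"
    and Y_Y: "\<lbrakk>1 \<le> i; i \<le> N; 1 \<le> j; j \<le> N\<rbrakk> \<Longrightarrow> Y i \<otimes> Y j = Y j \<otimes> Y i"
begin

section \<open>Partial products of the \<open>X i\<close> and the intertwiner
  \<open>Y (Suc i) \<otimes> T i\<close>\<close>

lemma P_closed [simp]: "k \<le> N \<Longrightarrow> P k \<in> carrier G"
  by (induction k) (simp_all add: P_0 P_Suc)

lemma X_P: "\<lbrakk>1 \<le> i; i \<le> N; k \<le> N\<rbrakk> \<Longrightarrow> X i \<otimes> P k = P k \<otimes> X i"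
proof (induction k)
  case (Suc k)
  then have IH: "X i \<otimes> P k = P k \<otimes> X i" by simp
  have "X i \<otimes> P (Suc k) = P k \<otimes> (X i \<otimes> X (Suc k))"
    using Suc.prems mult_assoc_cong[OF IH] by (simp add: P_Suc m_assoc)
  then show ?case
    using Suc.prems X_X[of i "Suc k"] by (simp add: P_Suc m_assoc)
qed (simp add: P_0)

text \<open>For \<open>k \<noteq> i\<close> the product \<open>P k\<close> contains both or neither
  of \<open>X i\<close> and \<open>X (Suc i)\<close>, and \<open>T i\<close> commutes with the
  product of these two.\<close>

lemma T_P: "\<lbrakk>1 \<le> i; i < N; k \<le> N; k \<noteq> i\<rbrakk> \<Longrightarrow> T i \<otimes> P k = P k \<otimes> T i"
\<comment> \<open>Strong induction: the case \<open>k = Suc i\<close> falls back on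
  \<open>i - 1\<close>, skipping the excluded index \<open>i\<close>.\<close>
proof (induction k rule: less_induct)
  case (less k)
  consider "k = 0" | "k = Suc i" | l where "k = Suc l" "l \<noteq> i"
    using not0_implies_Suc by blast
  then show ?case
  proof cases
    case 1
    then show ?thesis using less.prems by (simp add: P_0)
  next
    case 2
    obtain l where l: "i = Suc l"
      using less.prems by (cases i) auto
    have IH: "T i \<otimes> P l = P l \<otimes> T i"
      using less l 2 by simp
    have k: "P k = P l \<otimes> (X i \<otimes> X (Suc i))"
      using less.prems 2 l by (simp add: P_Suc m_assoc)
    have "T i \<otimes> (X i \<otimes> X (Suc i)) = T i \<otimes> (X i \<otimes> (T i \<otimes> (X i \<otimes> T i)))"
      using less.prems by (simp flip: TXT add: m_assoc)
    also have "\<dots> = X (Suc i) \<otimes> X i \<otimes> T i"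
      using less.prems by (simp flip: TXT add: m_assoc)
    also have "\<dots> = X i \<otimes> X (Suc i) \<otimes> T i"
      using less.prems by (simp add: X_X)
    finally have c: "T i \<otimes> (X i \<otimes> X (Suc i)) = X i \<otimes> X (Suc i) \<otimes> T i" .
    have "T i \<otimes> P k = P l \<otimes> (T i \<otimes> (X i \<otimes> X (Suc i)))"
      using less.prems mult_assoc_cong[OF IH] l by (simp add: k)
    also have "\<dots> = P k \<otimes> T i"
      unfolding c using less.prems l by (simp add: k m_assoc)
    finally show ?thesis .
  next
    case 3
    have IH: "T i \<otimes> P l = P l \<otimes> T i"
      using less 3 by simp
    have "T i \<otimes> P k = P l \<otimes> (T i \<otimes> X k)"
      using less.prems 3 mult_assoc_cong[OF IH] by (simp add: P_Suc)
    then show ?thesis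
      using less.prems 3 T_X[of i k] by (simp add: P_Suc m_assoc)
  qed
qed

lemma X_Y_Suc: "\<lbrakk>1 \<le> i; i < N\<rbrakk> \<Longrightarrow> X i \<otimes> Y (Suc i) = Y (Suc i) \<otimes> T i \<otimes> T i \<otimes> X i"
proof (induction i rule: nat_induct_at_least)
  case base
  then show ?case using X1_Y2 by (simp add: numeral_2_eq_2)
next
  case (Suc i)
  let ?a = "T i" and ?b = "T (Suc i)" and ?x = "X i" and ?y = "Y (Suc (Suc i))"
  have cl: "?a \<in> carrier G" "?b \<in> carrier G" "?x \<in> carrier G" "?y \<in> carrier G"
    using Suc by simp_all
  have bx: "?b \<otimes> ?x = ?x \<otimes> ?b" and ay: "?a \<otimes> ?y = ?y \<otimes> ?a"
    using Suc T_X[of "Suc i" i] T_Y[of i "Suc (Suc i)"] by simp_all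
  have br: "?a \<otimes> (?b \<otimes> ?a) = ?b \<otimes> (?a \<otimes> ?b)"
    using Suc braid[of i] cl by (simp add: m_assoc)
  have br': "?a \<otimes> (?b \<otimes> (?a \<otimes> z)) = ?b \<otimes> (?a \<otimes> (?b \<otimes> z))" if "z \<in> carrier G" for z
    using br cl that by (metis m_assoc m_closed)
  have Y: "Y (Suc i) = ?b \<otimes> (?y \<otimes> ?b)"
    using Suc TYT[of "Suc i"] cl by (simp add: m_assoc)
  have "?x \<otimes> Y (Suc i) = Y (Suc i) \<otimes> ?a \<otimes> ?a \<otimes> ?x"
    using Suc by simp
  then have "?b \<otimes> (?x \<otimes> (?y \<otimes> ?b)) = ?b \<otimes> (?y \<otimes> (?b \<otimes> (?a \<otimes> (?a \<otimes> ?x))))"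
    using cl mult_assoc_cong[OF bx] by (simp add: Y m_assoc)
  then have h: "?x \<otimes> (?y \<otimes> ?b) = ?y \<otimes> (?b \<otimes> (?a \<otimes> (?a \<otimes> ?x)))"
    using cl by simp
  \<comment> \<open>With \<open>T i\<close> put on the left of \<open>h\<close>, two braid moves
    turn \<open>abaa\<close> into \<open>baba\<close> and then \<open>bbab\<close>; the last
    \<open>b\<close> passes \<open>X i\<close> and cancels.\<close>
  have "?a \<otimes> ?x \<otimes> ?y \<otimes> ?b = ?y \<otimes> (?a \<otimes> (?b \<otimes> (?a \<otimes> (?a \<otimes> ?x))))"
    using cl h mult_assoc_cong[OF ay] by (simp add: m_assoc)
  also have "\<dots> = ?y \<otimes> ?b \<otimes> ?b \<otimes> ?a \<otimes> ?x \<otimes> ?b"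
    using cl bx br' by (simp add: m_assoc)
  finally have "?a \<otimes> ?x \<otimes> ?y = ?y \<otimes> ?b \<otimes> ?b \<otimes> ?a \<otimes> ?x"
    using cl by simp
  \<comment> \<open>The factor \<open>T i\<close> on the right completes \<open>X (Suc i)\<close> on
    both sides, as it commutes with \<open>?y\<close>.\<close>
  then have "?a \<otimes> ?x \<otimes> ?y \<otimes> ?a = ?y \<otimes> ?b \<otimes> ?b \<otimes> ?a \<otimes> ?x \<otimes> ?a"
    by simp
  moreover have "X (Suc i) = ?a \<otimes> ?x \<otimes> ?a"
    using Suc TXT by simp
  ultimately show ?case
    using cl ay by (simp add: m_assoc)
qed

lemma X_YT_int_pow:
  assumes "1 \<le> i" "i < N"
  shows "X i [^] (k::int) \<otimes> (Y (Suc i) \<otimes> T i) = Y (Suc i) \<otimes> T i \<otimes> X (Suc i) [^] k"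
proof (rule int_pow_intertwine)
  show "X i \<otimes> (Y (Suc i) \<otimes> T i) = Y (Suc i) \<otimes> T i \<otimes> X (Suc i)"
    using assms X_Y_Suc[OF assms] by (simp flip: TXT m_assoc)
qed (use assms in auto)

section \<open>The twisted elements and their relations with the \<open>T i\<close>\<close>

definition twist :: "int \<Rightarrow> nat \<Rightarrow> 'a" where
  "twist n i = P (i - 1) [^] (- n) \<otimes> Y i \<otimes> P i [^] n"

lemma twist_closed [simp]: "\<lbrakk>1 \<le> i; i \<le> N\<rbrakk> \<Longrightarrow> twist n i \<in> carrier G"
  by (simp add: twist_def)

text \<open>The two inequalities keep both \<open>i\<close> and \<open>i - 1\<close> away from
  \<open>j\<close>, so \<open>T j\<close> commutes with \<open>Y i\<close> and with both partial
  products.\<close>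

lemma T_twist:
  assumes "1 \<le> j" "j < N" "1 \<le> i" "i \<le> N" "i \<noteq> j" "i \<noteq> Suc j"
  shows "T j \<otimes> twist n i = twist n i \<otimes> T j"
proof -
  have P: "P k [^] m \<otimes> T j = T j \<otimes> P k [^] m" if "k \<le> N" "k \<noteq> j" for k and m :: int
    using assms that T_P[of j k] by (intro int_pow_intertwine) auto
  have 1: "P (i - 1) [^] (- n) \<otimes> T j = T j \<otimes> P (i - 1) [^] (- n)"
    and 2: "P i [^] n \<otimes> T j = T j \<otimes> P i [^] n"
    and 3: "Y i \<otimes> T j = T j \<otimes> Y i"
    using assms P T_Y by auto
  show ?thesis
    using assms mult_assoc_cong[OF 1] mult_assoc_cong[OF 3]
    by (simp add: twist_def m_assoc 2)
qed

lemma P_int_pow_Suc: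
  assumes "Suc k \<le> N"
  shows "P (Suc k) [^] (m::int) = X (Suc k) [^] m \<otimes> P k [^] m"
    and "P (Suc k) [^] (m::int) = P k [^] m \<otimes> X (Suc k) [^] m"
proof -
  have "P k \<otimes> X (Suc k) = X (Suc k) \<otimes> P k"
    using assms X_P by simp
  then show "P (Suc k) [^] m = X (Suc k) [^] m \<otimes> P k [^] m"
    "P (Suc k) [^] m = P k [^] m \<otimes> X (Suc k) [^] m"
    using assms int_pow_mult_distrib[of "P k" "X (Suc k)" m]
      int_pow_mult_distrib[of "X (Suc k)" "P k" m] by (simp_all add: P_Suc)
qed

lemma T_twist_T:
  assumes i: "1 \<le> i" "i < N"
  shows "T i \<otimes> twist n (Suc i) \<otimes> T i = twist n i"
proof -
  obtain l where l: "i = Suc l" using i by (cases i) auto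
  let ?t = "T i" and ?y = "Y (Suc i)" and ?p = "P l [^] (- n)" and ?q = "P i [^] n"
  have cl: "?t \<in> carrier G" "?y \<in> carrier G" "P l \<in> carrier G" "P i \<in> carrier G"
    "P (Suc i) \<in> carrier G" "X i \<in> carrier G" "X (Suc i) \<in> carrier G"
    using i l by simp_all
  have Pt: "P (Suc i) [^] n \<otimes> ?t = ?t \<otimes> P (Suc i) [^] n"
    using i cl T_P[of i "Suc i"] by (intro int_pow_intertwine) auto
  have pt: "?p \<otimes> ?t = ?t \<otimes> ?p"
    using i l cl T_P[of i l] by (intro int_pow_intertwine) auto
  \<comment> \<open>Moving \<open>T i\<close> to the left past the power of \<open>P (Suc i)\<close>
    forms the intertwiner. It turns the power of \<open>X i\<close> into one of
    \<open>X (Suc i)\<close>, which reduces \<open>P (Suc i) [^] n\<close> to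
    \<open>P i [^] n\<close>.\<close>
  have "twist n (Suc i) \<otimes> ?t = ?p \<otimes> (X i [^] (- n) \<otimes> (?y \<otimes> ?t)) \<otimes> P (Suc i) [^] n"
    using i l cl Pt P_int_pow_Suc(2)[of l "- n"] by (simp add: twist_def m_assoc)
  also have "\<dots> = ?p \<otimes> (?y \<otimes> (?t \<otimes> (X (Suc i) [^] (- n) \<otimes> P (Suc i) [^] n)))"
    unfolding X_YT_int_pow[OF i] using cl by (simp add: m_assoc)
  also have "\<dots> = ?p \<otimes> (?y \<otimes> (?t \<otimes> ?q))"
    using i cl P_int_pow_Suc(1)[of i n] by (simp add: int_pow_cancel)
  finally have e: "twist n (Suc i) \<otimes> ?t = ?p \<otimes> (?y \<otimes> (?t \<otimes> ?q))" .
  have "?t \<otimes> twist n (Suc i) \<otimes> ?t = ?t \<otimes> (?p \<otimes> (?y \<otimes> (?t \<otimes> ?q)))"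
    unfolding e[symmetric] using i by (simp add: m_assoc)
  also have "\<dots> = ?p \<otimes> (?t \<otimes> ?y \<otimes> ?t) \<otimes> ?q"
    using cl mult_assoc_cong[OF pt[symmetric]] by (simp add: m_assoc)
  also have "\<dots> = twist n i"
    using i l TYT by (simp add: twist_def)
  finally show ?thesis .
qed

lemma twist_1_2:
  assumes "2 \<le> N"
  shows "twist n 1 \<otimes> twist n 2 = twist n 2 \<otimes> twist n 1"
proof -
  let ?t = "T 1" and ?y = "Y 2" and ?x = "X 1" and ?x' = "X 2" and ?p = "P 2"
  have cl: "?t \<in> carrier G" "?y \<in> carrier G" "Y 1 \<in> carrier G" "?x \<in> carrier G"
    "?x' \<in> carrier G" "?p \<in> carrier G"
    using assms by simp_all
  have P1: "P 1 = ?x"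
    using cl P_Suc[of 0] by (simp add: P_0)
  have p: "?p [^] n = ?x' [^] n \<otimes> ?x [^] n"
    using assms P_int_pow_Suc(1)[of 1 n] P1 by (simp add: numeral_2_eq_2)
  have Y1: "?t \<otimes> ?y \<otimes> ?t = Y 1"
    using assms TYT[of 1] by (simp add: numeral_2_eq_2)
  have tw: "?x [^] (k::int) \<otimes> (?y \<otimes> ?t) = ?y \<otimes> ?t \<otimes> ?x' [^] k" for k
    using assms X_YT_int_pow[of 1 k] by (simp add: numeral_2_eq_2)
  have pt: "?p [^] n \<otimes> ?t = ?t \<otimes> ?p [^] n"
    using assms cl T_P[of 1 2] by (intro int_pow_intertwine) auto
  have z1: "twist n 1 = Y 1 \<otimes> ?x [^] n" and z2: "twist n 2 = ?x [^] (- n) \<otimes> ?y \<otimes> ?p [^] n"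
    using cl P1 by (simp_all add: twist_def P_0)
  \<comment> \<open>Writing \<open>Y 1\<close> as \<open>T 1 \<otimes> Y 2 \<otimes> T 1\<close>
    makes the intertwiner \<open>Y 2 \<otimes> T 1\<close> appear twice, once \<open>T 1\<close> has
    moved past \<open>P 2 [^] n\<close>.\<close>
  have "twist n 2 \<otimes> twist n 1 =
      ?x [^] (- n) \<otimes> ?y \<otimes> (?p [^] n \<otimes> ?t) \<otimes> ?y \<otimes> ?t \<otimes> ?x [^] n"
    unfolding z1 z2 Y1[symmetric] using cl by (simp add: m_assoc)
  also have "\<dots> = ?x [^] (- n) \<otimes> (?y \<otimes> ?t) \<otimes> (?p [^] n \<otimes> (?y \<otimes> (?t \<otimes> ?x [^] n)))"
    unfolding pt using cl by (simp add: m_assoc)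
  also have "\<dots> = ?y \<otimes> ?t \<otimes> (?x [^] n \<otimes> (?y \<otimes> ?t)) \<otimes> ?x [^] n"
    unfolding tw[of "- n"] p using cl by (simp add: m_assoc int_pow_cancel)
  also have "\<dots> = ?y \<otimes> (?t \<otimes> ?y \<otimes> ?t) \<otimes> ?p [^] n"
    unfolding tw p using cl by (simp add: m_assoc)
  also have "\<dots> = Y 1 \<otimes> ?y \<otimes> ?p [^] n"
    unfolding Y1 using assms Y_Y[of 1 2] by simp
  also have "\<dots> = twist n 1 \<otimes> twist n 2"
    unfolding z1 z2 using cl by (simp add: m_assoc int_pow_cancel)
  finally show ?thesis ..
qed

text \<open>Starting from the pair \<open>1, 2\<close>, first \<open>j\<close> is raised with
  \<open>i = 1\<close>, then \<open>i\<close> is raised below a fixed \<open>j\<close>. In each step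
  the \<open>T\<close> involved commutes with the element that stays.\<close>

lemma twist_commute_less:
  "\<lbrakk>1 \<le> i; i < j; j \<le> N\<rbrakk> \<Longrightarrow> twist n i \<otimes> twist n j = twist n j \<otimes> twist n i"
proof (induction i rule: nat_induct_at_least)
  case base
  have "Suc 1 \<le> j" using base by simp
  then show ?case using base
  proof (induction j rule: nat_induct_at_least)
    case base
    then show ?case using twist_1_2[of n] by (simp add: numeral_2_eq_2)
  next
    case (Suc j)
    have "twist n (Suc j) \<otimes> twist n 1 = twist n 1 \<otimes> twist n (Suc j)"
      using Suc by (intro commute_sandwich[OF T_twist_T[of j n]] T_twist) auto
    then show ?case by simp
  qed
next
  case (Suc i)
  then show ?case
    by (intro commute_sandwich[OF T_twist_T[of i n]] T_twist) auto
qed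

lemma twist_commute:
  assumes "1 \<le> i" "i \<le> N" "1 \<le> j" "j \<le> N"
  shows "twist n i \<otimes> twist n j = twist n j \<otimes> twist n i"
  using assms twist_commute_less[of i j n] twist_commute_less[of j i n]
  by (cases i j rule: linorder_cases) auto

end

section \<open>Passage to the unit group of the double affine Hecke algebra\<close>

lemma (in monoid) units_of_int_pow:
  assumes "x \<in> Units G"
  shows "x [^]\<^bsub>units_of G\<^esub> (k::int) = x [^] k"
proof -
  interpret U: group "units_of G" by (rule units_group)
  \<comment> \<open>A negative power is the inverse of a natural one, and the two inverses agree
    only on units.\<close>
  have "x [^] m \<in> Units G" for m :: nat
    using assms U.nat_pow_closed[of x m] by (simp add: units_of_carrier units_of_pow)
  with assms show ?thesis
    by (cases "k < 0") (simp_all only: int_pow_def2 if_True if_False units_of_pow units_of_inv)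
qed

definition daha_coset :: "nat \<Rightarrow> daha_free \<Rightarrow> daha_free set" where
  "daha_coset N a = daha_ideal N +>\<^bsub>free_algebra (daha_gens N)\<^esub> a"

lemma daha_coset_hom: "daha_coset N \<in> ring_hom (free_algebra (daha_gens N)) (daha N)"
  using ideal.rcos_ring_hom[OF daha_ideal_ideal] by (simp add: daha_coset_def[abs_def] daha_def)

lemma daha_coset_mult:
  assumes "a \<in> carrier (free_algebra (daha_gens N))" "b \<in> carrier (free_algebra (daha_gens N))"
  shows "daha_coset N (a * b) = daha_coset N a \<otimes>\<^bsub>daha N\<^esub> daha_coset N b"
  using ring_hom_mult[OF daha_coset_hom assms] by simp

lemma daha_coset_one: "daha_coset N 1 = \<one>\<^bsub>daha N\<^esub>"
  using ring_hom_one[OF daha_coset_hom] by simp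

lemma daha_coset_rel: "daha_rel N l r \<Longrightarrow> daha_coset N l = daha_coset N r"
  unfolding daha_coset_def by (rule daha_rel_imp_coset_eq)

lemma daha_coset_Units:
  assumes "a \<in> carrier (free_algebra (daha_gens N))" "b \<in> carrier (free_algebra (daha_gens N))"
    and "daha_rel N (a * b) 1" "daha_rel N (b * a) 1"
  shows "daha_coset N a \<in> Units (daha N)"
proof -
  have "daha_coset N a \<otimes>\<^bsub>daha N\<^esub> daha_coset N b = \<one>\<^bsub>daha N\<^esub>"
    "daha_coset N b \<otimes>\<^bsub>daha N\<^esub> daha_coset N a = \<one>\<^bsub>daha N\<^esub>"
    using assms by (simp_all add: daha_coset_rel daha_coset_one flip: daha_coset_mult)
  then show ?thesis
    using assms ring_hom_closed[OF daha_coset_hom] unfolding Units_def by blast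
qed

lemma daha_gen_closed:
  "\<lbrakk>1 \<le> i; i \<le> N\<rbrakk> \<Longrightarrow> fX i \<in> carrier (free_algebra (daha_gens N))"
  "\<lbrakk>1 \<le> i; i \<le> N\<rbrakk> \<Longrightarrow> fY i \<in> carrier (free_algebra (daha_gens N))"
  "\<lbrakk>1 \<le> i; i \<le> N\<rbrakk> \<Longrightarrow> fYinv i \<in> carrier (free_algebra (daha_gens N))"
  "\<lbrakk>1 \<le> i; i < N\<rbrakk> \<Longrightarrow> fT i \<in> carrier (free_algebra (daha_gens N))"
  "\<lbrakk>1 \<le> i; i < N\<rbrakk> \<Longrightarrow> fTinv i \<in> carrier (free_algebra (daha_gens N))"
  by (auto intro!: free_algebra_carrier_simps simp: daha_gens_def)

lemma daha_double_affine_braid: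
  "double_affine_braid (units_of (daha N)) N (daha_X N) (daha_Y N)
    (\<lambda>i. daha_coset N (fT i)) (daha_X_prod N)"
proof -
  interpret ring "daha N" by (rule daha_ring)
  interpret U: group "units_of (daha N)" by (rule units_group)
  have X: "daha_X N i = daha_coset N (fX i)" and Y: "daha_Y N i = daha_coset N (fY i)" for i
    by (simp_all add: daha_X_def daha_Y_def daha_coset_def)
  note [simp] = units_of_mult units_of_one units_of_carrier
  note cl [simp] = daha_gen_closed free_algebra_carrier_closed(2)
  \<comment> \<open>Gathers a product of cosets into the coset of one word, to which a defining
    relation applies.\<close>
  note cm = daha_coset_mult[symmetric]
  show ?thesis
  proof
    fix i assume i: "1 \<le> i" "i < N"
    let ?t = "daha_coset N (fT i)" and ?t' = "daha_coset N (fTinv i)"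
      and ?y = "daha_coset N (fY i)"
    have c: "?t \<in> carrier (daha N)" "?t' \<in> carrier (daha N)" "?y \<in> carrier (daha N)"
      using i ring_hom_closed[OF daha_coset_hom] by simp_all
    have tt: "?t \<otimes>\<^bsub>daha N\<^esub> ?t' = \<one>\<^bsub>daha N\<^esub>" "?t' \<otimes>\<^bsub>daha N\<^esub> ?t = \<one>\<^bsub>daha N\<^esub>"
      using i daha_coset_rel[OF daha_rel.T_Tinv, of i N] daha_coset_rel[OF daha_rel.Tinv_T, of i N]
      by (simp_all add: cm daha_coset_one)
    have "daha_coset N (fY (Suc i)) = ?t' \<otimes>\<^bsub>daha N\<^esub> ?y \<otimes>\<^bsub>daha N\<^esub> ?t'"
      using i daha_coset_rel[OF daha_rel.TYT, of i N] by (simp add: cm)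
    \<comment> \<open>The defining relation has inverses of \<open>T i\<close> around
      \<open>Y i\<close>; multiplying by \<open>T i\<close> on both sides gives the form in the
      locale.\<close>
    then have "?t \<otimes>\<^bsub>daha N\<^esub> daha_coset N (fY (Suc i)) \<otimes>\<^bsub>daha N\<^esub> ?t =
        (?t \<otimes>\<^bsub>daha N\<^esub> ?t') \<otimes>\<^bsub>daha N\<^esub> ?y \<otimes>\<^bsub>daha N\<^esub> (?t' \<otimes>\<^bsub>daha N\<^esub> ?t)"
      using c by (simp add: m_assoc)
    then show "?t \<otimes>\<^bsub>units_of (daha N)\<^esub> daha_Y N (Suc i) \<otimes>\<^bsub>units_of (daha N)\<^esub> ?t = daha_Y N i"
      using c by (simp add: tt Y)
    show "?t \<in> carrier (units_of (daha N))"
      using i daha_coset_Units[of "fT i" N "fTinv i"] daha_rel.T_Tinv daha_rel.Tinv_T by simp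
    show "?t \<otimes>\<^bsub>units_of (daha N)\<^esub> daha_X N i \<otimes>\<^bsub>units_of (daha N)\<^esub> ?t = daha_X N (Suc i)"
      using i daha_coset_rel[OF daha_rel.TXT, of i N] by (simp add: X cm)
  next
    fix i assume "1 \<le> i" "i \<le> N"
    then show "daha_X N i \<in> carrier (units_of (daha N))"
      "daha_Y N i \<in> carrier (units_of (daha N))"
      using daha_X_Units daha_coset_Units[of "fY i" N "fYinv i"] daha_rel.Y_Yinv daha_rel.Yinv_Y
      by (simp_all add: Y)
  next
    fix i assume "1 \<le> i" "Suc i < N"
    then show "daha_coset N (fT i) \<otimes>\<^bsub>units_of (daha N)\<^esub> daha_coset N (fT (Suc i))
        \<otimes>\<^bsub>units_of (daha N)\<^esub> daha_coset N (fT i) =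
      daha_coset N (fT (Suc i)) \<otimes>\<^bsub>units_of (daha N)\<^esub> daha_coset N (fT i)
        \<otimes>\<^bsub>units_of (daha N)\<^esub> daha_coset N (fT (Suc i))"
      using daha_coset_rel[OF daha_rel.braid, of i N] by (simp add: cm)
  next
    fix i j assume "1 \<le> i" "i < N" "1 \<le> j" "j \<le> N" "j \<noteq> i" "j \<noteq> Suc i"
    then show "daha_coset N (fT i) \<otimes>\<^bsub>units_of (daha N)\<^esub> daha_X N j =
        daha_X N j \<otimes>\<^bsub>units_of (daha N)\<^esub> daha_coset N (fT i)"
      "daha_coset N (fT i) \<otimes>\<^bsub>units_of (daha N)\<^esub> daha_Y N j =
        daha_Y N j \<otimes>\<^bsub>units_of (daha N)\<^esub> daha_coset N (fT i)"
      using daha_coset_rel[OF daha_rel.T_X, of i N j] daha_coset_rel[OF daha_rel.T_Y, of i N j]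
      by (simp_all add: X Y cm)
  next
    fix i j assume "1 \<le> i" "i \<le> N" "1 \<le> j" "j \<le> N"
    then show "daha_X N i \<otimes>\<^bsub>units_of (daha N)\<^esub> daha_X N j =
        daha_X N j \<otimes>\<^bsub>units_of (daha N)\<^esub> daha_X N i"
      "daha_Y N i \<otimes>\<^bsub>units_of (daha N)\<^esub> daha_Y N j =
        daha_Y N j \<otimes>\<^bsub>units_of (daha N)\<^esub> daha_Y N i"
      using daha_coset_rel[OF daha_rel.X_X, of i N j] daha_coset_rel[OF daha_rel.Y_Y, of i N j]
      by (simp_all add: X Y cm)
  next
    assume "2 \<le> N"
    then show "daha_X N 1 \<otimes>\<^bsub>units_of (daha N)\<^esub> daha_Y N 2 =
      daha_Y N 2 \<otimes>\<^bsub>units_of (daha N)\<^esub> daha_coset N (fT 1)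
        \<otimes>\<^bsub>units_of (daha N)\<^esub> daha_coset N (fT 1) \<otimes>\<^bsub>units_of (daha N)\<^esub> daha_X N 1"
      using daha_coset_rel[OF daha_rel.X1_Y2, of N]
      by (simp add: X Y cm power2_eq_square mult.assoc)
  qed simp_all
qed

theorem lemma2p7:
  fixes N :: nat and n :: int
  assumes "N \<ge> 1"
  shows "\<forall>i \<in> {1..N}. \<forall>j \<in> {1..N}.
    daha_Y_twist N i n \<otimes>\<^bsub>daha N\<^esub> daha_Y_twist N j n =
    daha_Y_twist N j n \<otimes>\<^bsub>daha N\<^esub> daha_Y_twist N i n"
proof -
  interpret R: ring "daha N" by (rule daha_ring)
  interpret B: double_affine_braid "units_of (daha N)" N "daha_X N" "daha_Y N"
    "\<lambda>i. daha_coset N (fT i)" "daha_X_prod N"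
    by (rule daha_double_affine_braid)
  \<comment> \<open>The powers on the left are taken in the ring, those on the right in its unit
    group; they agree because \<open>P_closed\<close> makes both partial products units.\<close>
  have "daha_Y_twist N i n = B.twist n i" if "i \<in> {1..N}" for i
    using that B.P_closed[of i] B.P_closed[of "i - 1"] less_imp_diff_less[of i "Suc N" 1]
    by (simp add: daha_Y_twist_def B.twist_def R.units_of_int_pow units_of_carrier units_of_mult)
  then show ?thesis
    using B.twist_commute by (simp add: units_of_mult)
qed

end
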